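(* Let $\delta_t\in[0,+\infty)$, $t=1,\dots,T$, be given and define $$\epsilon_t:=\begin{cases}0,& t=T-1,\\ \sum_{\tau=t}^{T-2}(M_{\tau+1}+\underline M_{\tau+1})\,\delta_{\tau+1}\,\lambda^{\tau-t},& 0\le t\le T-2.\end{cases}$$ Then every iteration $k$ of the DDP method either generates a $\delta_t$-distinguishable and $\epsilon_t$-saturated search point $x_t^k$ at some stage $t\in\{1,\dots,T-1\}$, or finds a feasible policy $(x_1^k,\dots,x_T^k)$ such that $$f_1(x_1^k)-f^*\le\epsilon_0\qquad\text{and}\qquad\sum_{t=1}^T\lambda^{t-1}h_t(x_t^k)-\underline f_1^{k-1}(x_1^k)\le\sum_{t=1}^T\lambda^{t-1}\epsilon_{t-1}.$$
   Context: **Problem.** $T\ge2$ is the number of stages, $\lambda\in(0,1]$ a discount factor, $\|\cdot\|$ a norm. For $t=1,\dots,T$: $\bar X_t\subseteq\mathbb R^{n_t}$ is closed convex; $h_t$ is a closed convex objective function; $\phi_t=(\phi_{t,1},\dots,\phi_{t,p_t})$ has closed convex component functions on $\bar X_t$; $A_t:\mathbb R^{n_t}\to\mathbb R^{m_t}$, $B_t:\mathbb R^{n_{t-1}}\to\mathbb R^{m_t}$, $Q_t:\mathbb R^{n_{t-1}}\to\mathbb R^{p_t}$ are linear and $b_t\in\mathbb R^{m_t}$. For $t\ge2$, $X_t(x_{t-1}):=\{x\in\bar X_t: A_tx=B_tx_{t-1}+b_t,\ \phi_t(x)\le Q_tx_{t-1}\}$; $X_1:=\{x\in\bar X_1:A_1x=b_1,\phi_1(x)\le0\}$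 and $X_1(x_0)\equiv X_1$. Value functions: $v_{T+1}\equiv0$, $f_t(x):=h_t(x)+\lambda v_{t+1}(x)$, $v_t(x_{t-1}):=\min_{x\in X_t(x_{t-1})}f_t(x)$ for $t=T,\dots,2$. The problem is $f^*:=\min_{x_1\in X_1}f_1(x_1)$. A feasible policy is $(x_1,\dots,x_T)$ with $x_t\in X_t(x_{t-1})$ for all $t$. **Effective regions.** $\mathcal X_1:=X_1$, $\mathcal X_t:=\bigcup_{x\in\mathcal X_{t-1}}X_t(x)$ for $t\ge2$; $\mathcal X_t(\epsilon):=\mathcal X_t+\{y\in\mathrm{Aff}(\mathcal X_t):\|y\|\le\epsilon\}$, where $\mathrm{Aff}$ denotes the affine hull (in the second summand, its direction space). **Standing assumptions.** (1) For each $t$ there is $D_t\ge0$ with $\|x-x'\|\le D_t$ for all $x,x'\in\mathcal X_t$. (2) For each $t$ there is $\bar\epsilon_t\in(0,\infty)$ with $h_t(x)<+\infty$ and (for $t\le T-1$) the relative interior of $X_{t+1}(x)$ nonempty, for all $x\in\mathcal X_t(\bar\epsilon_t)$. (3) $M_t\ge0$ satisfies $|f_t(x)-f_t(x')|\le M_t\|x-x'\|$ for all $x,x'\in\mathcal X_t$. **DDP method.** Set $\underline v_t^0\equiv-\infty$ for $t=2,\dots,T$ and $\underline v_{T+1}^k\equiv0$ for all $k\ge0$; write $\underline f_t^k(x):=h_t(x)+\lambda\underline v_{t+1}^k(x)$. Iteration $k=1,2,\dots$: Forward phase, $t=1,\dots,T$: $x_t^k\in\operatorname{Argmin}\{\underline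 f_t^{k-1}(x):x\in X_t(x_{t-1}^k)\}$ (if $k=1$ and $t<T$ the objective is $-\infty$ and $x_t^1$ is any feasible point). Backward phase, $t=T,T-1,\dots,2$: $\tilde v_t^k(x_{t-1}^k)=\min\{\underline f_t^k(x):x\in X_t(x_{t-1}^k)\}$; $(\tilde v_t^k)'(x_{t-1}^k)=[B_t,Q_t]y_t^k$ with $y_t^k$ an optimal dual multiplier of this problem (read with the appropriate adjoints/signs, so that it is a subgradient at $x_{t-1}^k$ of $\tilde v_t^k(x):=\min\{\underline f_t^k(y):y\in X_t(x)\}$); $\underline v_t^k(x)=\max\{\underline v_t^{k-1}(x),\ \tilde v_t^k(x_{t-1}^k)+\langle(\tilde v_t^k)'(x_{t-1}^k),x-x_{t-1}^k\rangle\}$. The minimizers and multipliers used are taken to exist (the paper regards this as ensured by assumption (2)). **Constants.** $\underline M_t\ge0$ is a constant with $|\underline f_t^k(x)-\underline f_t^k(x')|\le\underline M_t\|x-x'\|$ for all $x,x'\in\mathcal X_t$ and all $k\ge1$. **Saturation and distinguishability.** The search point $x_t^k$ is $\epsilon_t$-saturated (at iteration $k$) if $v_{t+1}(x_t^k)-\underline v_{t+1}^k(x_t^k)\le\epsilon_t$. $S_t^{k-1}$ is the set of $\epsilon_t$-saturated search points of stage $t$ generated before iteration $k$. For $t<T$, $x_t^k$ is $\delta_t$-distinguishable if $\min_{s\in S_t^{k-1}}\|s-x_t^k\|>\delta_t$ (the minimum over the empty set being $+\infty$); for $t=T$ this distance is defined to be $0$. *)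

theory Defs
  imports "HOL-Analysis.Analysis" "HOL-Analysis.Finite_Function_Topology"
begin

text \<open>
  The dimensions of the stage problems vary with the stage, so all vectors live in the
  type of finitely supported real sequences, whose library topology and vector space structure
  restrict to the usual ones on the coordinate subspaces \<open>rspace d\<close>, playing the role of the
  \<open>d\<close>-dimensional coordinate space.
\<close>

type_synonym rvec = "nat \<Rightarrow>\<^sub>0 real"

definition rspace :: "nat \<Rightarrow> rvec set" where
  "rspace d = {x. Poly_Mapping.keys x \<subseteq> {..<d}}"

definition dot :: "rvec \<Rightarrow> rvec \<Rightarrow> real" where
  "dot x y = (\<Sum>i\<in>Poly_Mapping.keys x. Poly_Mapping.lookup x i * Poly_Mapping.lookup y i)"

text \<open>The adjoint of a linear map \<open>L\<close> defined on \<open>rspace d\<close>, i.e. the transposed matrix.\<close>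

definition adj :: "nat \<Rightarrow> (rvec \<Rightarrow> rvec) \<Rightarrow> rvec \<Rightarrow> rvec" where
  "adj d L y = (\<Sum>j<d. Poly_Mapping.single j (dot (L (Poly_Mapping.single j 1)) y))"

definition linear_between :: "nat \<Rightarrow> nat \<Rightarrow> (rvec \<Rightarrow> rvec) \<Rightarrow> bool" where
  "linear_between d e L \<longleftrightarrow> linear L \<and> L ` rspace d \<subseteq> rspace e"

definition norm_on :: "rvec set \<Rightarrow> (rvec \<Rightarrow> real) \<Rightarrow> bool" where
  "norm_on V N \<longleftrightarrow>
     (\<forall>x\<in>V. 0 \<le> N x \<and> (N x = 0 \<longleftrightarrow> x = 0)) \<and>
     (\<forall>x\<in>V. \<forall>c. N (c *\<^sub>R x) = \<bar>c\<bar> * N x) \<and>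
     (\<forall>x\<in>V. \<forall>y\<in>V. N (x + y) \<le> N x + N y)"

text \<open>Closed convex functions on \<open>V\<close> with values in the half-open interval from
  \<open>-\<infinity>\<close> (excluded) to \<open>\<infinity>\<close> (included).\<close>

definition closed_convex_on :: "rvec set \<Rightarrow> (rvec \<Rightarrow> ereal) \<Rightarrow> bool" where
  "closed_convex_on V g \<longleftrightarrow>
     (\<forall>x\<in>V. g x \<noteq> -\<infinity>) \<and>
     closed {(x, r :: real). x \<in> V \<and> g x \<le> ereal r} \<and>
     convex {(x, r :: real). x \<in> V \<and> g x \<le> ereal r}"

text \<open>All stage-indexed data are functions of the stage number; only the stages
  \<open>1, ..., stages P\<close> matter (\<open>2, ..., stages P\<close> for \<open>opB\<close> and \<open>opQ\<close>).\<close>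

record problem =
  stages :: nat
  disc :: real
  dimx :: "nat \<Rightarrow> nat"
  dime :: "nat \<Rightarrow> nat"
  dimi :: "nat \<Rightarrow> nat"
  nrm :: "nat \<Rightarrow> rvec \<Rightarrow> real"
  Xbar :: "nat \<Rightarrow> rvec set"
  hobj :: "nat \<Rightarrow> rvec \<Rightarrow> ereal"
  phi :: "nat \<Rightarrow> nat \<Rightarrow> rvec \<Rightarrow> real"
  opA :: "nat \<Rightarrow> rvec \<Rightarrow> rvec"
  opB :: "nat \<Rightarrow> rvec \<Rightarrow> rvec"
  opQ :: "nat \<Rightarrow> rvec \<Rightarrow> rvec"
  rhs :: "nat \<Rightarrow> rvec"

definition convex_problem :: "problem \<Rightarrow> bool" where
  "convex_problem P \<longleftrightarrow>
     2 \<le> stages P \<and> 0 < disc P \<and> disc P \<le> 1 \<and>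
     (\<forall>t\<in>{1..stages P}.
        norm_on (rspace (dimx P t)) (nrm P t) \<and>
        Xbar P t \<subseteq> rspace (dimx P t) \<and> closed (Xbar P t) \<and> convex (Xbar P t) \<and>
        closed_convex_on (rspace (dimx P t)) (hobj P t) \<and>
        (\<forall>i<dimi P t. convex_on (Xbar P t) (phi P t i) \<and>
                       closed (epigraph (Xbar P t) (phi P t i))) \<and>
        linear_between (dimx P t) (dime P t) (opA P t) \<and>
        rhs P t \<in> rspace (dime P t)) \<and>
     (\<forall>t\<in>{2..stages P}.
        linear_between (dimx P (t - 1)) (dime P t) (opB P t) \<and>
        linear_between (dimx P (t - 1)) (dimi P t) (opQ P t))"

text \<open>The set \<open>X\<^sub>t(u)\<close>; for \<open>t = 1\<close> the argument \<open>u\<close> is ignored.\<close>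

definition feas :: "problem \<Rightarrow> nat \<Rightarrow> rvec \<Rightarrow> rvec set" where
  "feas P t u =
     (if t = 1
      then {x \<in> Xbar P t. opA P t x = rhs P t \<and> (\<forall>i<dimi P t. phi P t i x \<le> 0)}
      else {x \<in> Xbar P t. opA P t x = opB P t u + rhs P t \<and>
              (\<forall>i<dimi P t. phi P t i x \<le> Poly_Mapping.lookup (opQ P t u) i)})"

definition feasible_policy :: "problem \<Rightarrow> (nat \<Rightarrow> rvec) \<Rightarrow> bool" where
  "feasible_policy P x \<longleftrightarrow> (\<forall>t\<in>{1..stages P}. x t \<in> feas P t (x (t - 1)))"

text \<open>The minima defining the value functions are written as infima in the extended reals,
  so that infeasible problems have value \<open>\<infinity>\<close>.\<close>

function vfun :: "problem \<Rightarrow> nat \<Rightarrow> rvec \<Rightarrow> ereal" where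
  "vfun P t u =
     (if stages P < t then 0
      else INF z\<in>feas P t u. hobj P t z + ereal (disc P) * vfun P (Suc t) z)"
  by pat_completeness auto
termination
  by (relation "Wellfounded.measure (\<lambda>(P, t, u). Suc (stages P) - t)") auto

declare vfun.simps [simp del]

definition ffun :: "problem \<Rightarrow> nat \<Rightarrow> rvec \<Rightarrow> ereal" where
  "ffun P t z = hobj P t z + ereal (disc P) * vfun P (Suc t) z"

definition fstar :: "problem \<Rightarrow> ereal" where
  "fstar P = (INF z\<in>feas P 1 0. ffun P 1 z)"

text \<open>The effective feasible region of each stage. The region of stage \<open>0\<close> is a dummy
  singleton, since \<open>feas P 1\<close> is constant.\<close>

primrec region :: "problem \<Rightarrow> nat \<Rightarrow> rvec set" where
  "region P 0 = {0}"
| "region P (Suc t) = (\<Union>u\<in>region P t. feas P (Suc t) u)"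

definition enlarged_region :: "problem \<Rightarrow> nat \<Rightarrow> real \<Rightarrow> rvec set" where
  "enlarged_region P t e =
     {x + (a - b) | x a b. x \<in> region P t \<and> a \<in> affine hull region P t \<and>
        b \<in> affine hull region P t \<and> nrm P t (a - b) \<le> e}"

text \<open>Lagrangian duality for the problem of minimizing \<open>g\<close> over \<open>feas P t u\<close> (\<open>t \<ge> 2\<close>), with the
  set constraint \<open>Xbar P t\<close> kept explicit. A multiplier is a pair \<open>(\<mu>, \<nu>)\<close> for the equality and the
  inequality constraints. It is optimal if it maximizes the dual function without duality gap.
  With this sign convention, the subgradient of the optimal value with respect to \<open>u\<close> is
  \<open>B\<^sub>t\<^sup>T \<mu> - Q\<^sub>t\<^sup>T \<nu>\<close>.\<close>

definition dual_fun ::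
  "problem \<Rightarrow> nat \<Rightarrow> rvec \<Rightarrow> (rvec \<Rightarrow> ereal) \<Rightarrow> rvec \<times> rvec \<Rightarrow> ereal" where
  "dual_fun P t u g y =
     (INF z\<in>Xbar P t. g z + ereal
        (dot (opB P t u + rhs P t - opA P t z) (fst y) +
         (\<Sum>i<dimi P t. Poly_Mapping.lookup (snd y) i *
            (phi P t i z - Poly_Mapping.lookup (opQ P t u) i))))"

definition dual_feasible :: "problem \<Rightarrow> nat \<Rightarrow> rvec \<times> rvec \<Rightarrow> bool" where
  "dual_feasible P t y \<longleftrightarrow>
     fst y \<in> rspace (dime P t) \<and> snd y \<in> rspace (dimi P t) \<and>
     (\<forall>i. 0 \<le> Poly_Mapping.lookup (snd y) i)"

definition optimal_multiplier ::
  "problem \<Rightarrow> nat \<Rightarrow> rvec \<Rightarrow> (rvec \<Rightarrow> ereal) \<Rightarrow> rvec \<times> rvec \<Rightarrow> bool" where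
  "optimal_multiplier P t u g y \<longleftrightarrow>
     dual_feasible P t y \<and>
     (\<forall>y'. dual_feasible P t y' \<longrightarrow> dual_fun P t u g y' \<le> dual_fun P t u g y) \<and>
     dual_fun P t u g y = (INF z\<in>feas P t u. g z)"

definition cut_slope :: "problem \<Rightarrow> nat \<Rightarrow> rvec \<times> rvec \<Rightarrow> rvec" where
  "cut_slope P t y =
     adj (dimx P (t - 1)) (opB P t) (fst y) - adj (dimx P (t - 1)) (opQ P t) (snd y)"

text \<open>The lower approximations \<open>lowv P x y k t\<close> of \<open>vfun P t\<close> produced by the search points
  \<open>x k t\<close> and multipliers \<open>y k t\<close>. They are meaningful for \<open>t \<ge> 2\<close>.\<close>

function lowv ::
  "problem \<Rightarrow> (nat \<Rightarrow> nat \<Rightarrow> rvec) \<Rightarrow> (nat \<Rightarrow> nat \<Rightarrow> rvec \<times> rvec) \<Rightarrow>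
   nat \<Rightarrow> nat \<Rightarrow> rvec \<Rightarrow> ereal" where
  "lowv P x y k t u =
     (if stages P < t then 0
      else if k = 0 then -\<infinity>
      else max (lowv P x y (k - 1) t u)
        ((INF z\<in>feas P t (x k (t - 1)).
            hobj P t z + ereal (disc P) * lowv P x y k (Suc t) z)
         + ereal (dot (cut_slope P t (y k t)) (u - x k (t - 1)))))"
  by pat_completeness auto
termination
  by (relation "measures [\<lambda>(P, x, y, k, t, u). k, \<lambda>(P, x, y, k, t, u). Suc (stages P) - t]") auto

declare lowv.simps [simp del]

definition lowf ::
  "problem \<Rightarrow> (nat \<Rightarrow> nat \<Rightarrow> rvec) \<Rightarrow> (nat \<Rightarrow> nat \<Rightarrow> rvec \<times> rvec) \<Rightarrow>
   nat \<Rightarrow> nat \<Rightarrow> rvec \<Rightarrow> ereal" where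
  "lowf P x y k t z = hobj P t z + ereal (disc P) * lowv P x y k (Suc t) z"

text \<open>Iterations are numbered from \<open>1\<close>. In the first iteration the objective is \<open>-\<infinity>\<close>
  wherever \<open>hobj\<close> is finite, so that every feasible point is then a minimizer for \<open>t < stages P\<close>.\<close>

definition ddp_run ::
  "problem \<Rightarrow> (nat \<Rightarrow> nat \<Rightarrow> rvec) \<Rightarrow> (nat \<Rightarrow> nat \<Rightarrow> rvec \<times> rvec) \<Rightarrow> bool" where
  "ddp_run P x y \<longleftrightarrow>
     (\<forall>k\<ge>1.
        (\<forall>t\<in>{1..stages P}.
           is_arg_min (lowf P x y (k - 1) t) (\<lambda>z. z \<in> feas P t (x k (t - 1))) (x k t)) \<and>
        (\<forall>t\<in>{2..stages P}.
           optimal_multiplier P t (x k (t - 1)) (lowf P x y k t) (y k t)))"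

definition saturated ::
  "problem \<Rightarrow> (nat \<Rightarrow> nat \<Rightarrow> rvec) \<Rightarrow> (nat \<Rightarrow> nat \<Rightarrow> rvec \<times> rvec) \<Rightarrow>
   real \<Rightarrow> nat \<Rightarrow> nat \<Rightarrow> bool" where
  "saturated P x y e k t \<longleftrightarrow>
     vfun P (Suc t) (x k t) - lowv P x y k (Suc t) (x k t) \<le> ereal e"

definition sat_points ::
  "problem \<Rightarrow> (nat \<Rightarrow> nat \<Rightarrow> rvec) \<Rightarrow> (nat \<Rightarrow> nat \<Rightarrow> rvec \<times> rvec) \<Rightarrow>
   real \<Rightarrow> nat \<Rightarrow> nat \<Rightarrow> rvec set" where
  "sat_points P x y e k t = {x j t | j. 1 \<le> j \<and> j < k \<and> saturated P x y e j t}"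

definition distinguishable ::
  "problem \<Rightarrow> (nat \<Rightarrow> nat \<Rightarrow> rvec) \<Rightarrow> (nat \<Rightarrow> nat \<Rightarrow> rvec \<times> rvec) \<Rightarrow>
   real \<Rightarrow> real \<Rightarrow> nat \<Rightarrow> nat \<Rightarrow> bool" where
  "distinguishable P x y e d k t \<longleftrightarrow>
     ereal d < (if t < stages P
                then INF s\<in>sat_points P x y e k t. ereal (nrm P t (s - x k t)) else 0)"

definition eps ::
  "problem \<Rightarrow> (nat \<Rightarrow> real) \<Rightarrow> (nat \<Rightarrow> real) \<Rightarrow> (nat \<Rightarrow> real) \<Rightarrow> nat \<Rightarrow> real" where
  "eps P M LM \<delta> t =
     (if t = stages P - 1 then 0
      else \<Sum>\<tau>=t..stages P - 2.
        (M (\<tau> + 1) + LM (\<tau> + 1)) * \<delta> (\<tau> + 1) * disc P ^ (\<tau> - t))"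

end

theory Submission
  imports Defs
begin

text \<open>
  Two facts about the lower approximations carry the result. They are valid, by
  \<open>lowv_le_vfun\<close>: the dual function of a stage problem is, up to the affine term with slope
  \<open>cut_slope\<close>, the same for all right-hand sides, so weak duality at one right-hand side
  extends a dual optimum to an affine minorant of the optimal value, and replacing the future
  cost by a lower bound only lowers that value. And they only grow with the iteration
  number, so a search point saturated at an earlier iteration still is.

  Suppose that no search point of iteration \<open>k\<close> is both saturated and distinguishable. The
  last but one search point is saturated with error \<open>0\<close>, since no cost lies beyond the last
  stage and the newest cut is exact at the point where it is built. A saturated point of a
  stage \<open>t\<close> is not distinguishable, hence lies within \<open>\<delta>\<^sub>t\<close> of an older
  saturated point. Moving there with the Lipschitz constant of the true objective, comparing the
  two objectives there by saturation, and moving back with the Lipschitz constant of the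
  approximate objective of iteration \<open>k - 1\<close> costs
  \<open>(M\<^sub>t + LM\<^sub>t) \<delta>\<^sub>t + \<lambda> \<epsilon>\<^sub>t = \<epsilon>\<^sub>t\<^sub>-\<^sub>1\<close>
  (\<open>gap_at_indistinguishable_point\<close>, \<open>eps_recursion\<close>). As the search point of stage \<open>t\<close>
  minimizes the approximate objective, this gap bounds the error of the next cut at the
  preceding search point, which is therefore \<open>\<epsilon>\<^sub>t\<^sub>-\<^sub>1\<close>-saturated
  (\<open>saturated_previous\<close>). The argument descends in this way to stage \<open>1\<close>, and there the gap is
  the optimality bound, because the approximate minimum lies below the true one.

  For the cost of the policy, the gap at stage \<open>t\<close> also says that the approximate
  cost-to-go at the search point is within \<open>\<epsilon>\<^sub>t\<^sub>-\<^sub>1 / \<lambda>\<close> of the true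
  one, which in turn is at least the approximate optimal value of stage \<open>t + 1\<close>. Discounting
  and summing these inequalities telescopes (\<open>discounted_telescope\<close>).
\<close>

section \<open>The bilinear form and the adjoint\<close>

lemma dot_eq_sum:
  assumes "finite A" "Poly_Mapping.keys u \<subseteq> A"
  shows "dot u w = (\<Sum>i\<in>A. Poly_Mapping.lookup u i * Poly_Mapping.lookup w i)"
  unfolding dot_def using assms by (intro sum.mono_neutral_left) (auto simp: in_keys_iff)

lemma lookup_scaleR_poly: "Poly_Mapping.lookup (c *\<^sub>R u) i = c * Poly_Mapping.lookup (u::rvec) i"
proof -
  have "finite {i. c * Poly_Mapping.lookup u i \<noteq> 0}"
    by (rule finite_subset[OF _ finite_keys[of u]]) (auto simp: in_keys_iff)
  then show ?thesis
    by (simp add: scaleR_poly_mapping_def)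
qed

lemma dot_add_left: "dot (u + w) z = dot u z + dot w z"
  using keys_add[of u w]
  by (simp add: dot_eq_sum[of "Poly_Mapping.keys u \<union> Poly_Mapping.keys w"]
      lookup_add distrib_right sum.distrib)

lemma dot_diff_left: "dot (u - w) z = dot u z - dot w z"
  using dot_add_left[of "u - w" w z] by simp

lemma dot_scaleR_left: "dot (c *\<^sub>R u) z = c * dot u z"
proof -
  have "Poly_Mapping.keys (c *\<^sub>R u) \<subseteq> Poly_Mapping.keys u"
    by (auto simp: in_keys_iff lookup_scaleR_poly)
  then show ?thesis
    by (simp add: dot_eq_sum[of "Poly_Mapping.keys u"] lookup_scaleR_poly sum_distrib_left mult.assoc)
qed

lemma dot_sum_left: "dot (\<Sum>i\<in>A. f i) z = (\<Sum>i\<in>A. dot (f i) z)"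
proof -
  have "dot 0 z = 0"
    by (simp add: dot_def)
  then show ?thesis
    by (induction A rule: infinite_finite_induct) (auto simp: dot_add_left)
qed

lemma dot_single: "dot (Poly_Mapping.single i c) w = c * Poly_Mapping.lookup w i"
  by (simp add: dot_eq_sum[of "{i}"])

lemma rspace_expansion:
  assumes "w \<in> rspace d"
  shows "w = (\<Sum>i<d. Poly_Mapping.lookup w i *\<^sub>R Poly_Mapping.single i 1)"
proof (rule poly_mapping_eqI)
  fix k
  have "Poly_Mapping.lookup w k = 0" if "\<not> k < d"
    using assms that by (auto simp: rspace_def in_keys_iff)
  then show "Poly_Mapping.lookup w k
      = Poly_Mapping.lookup (\<Sum>i<d. Poly_Mapping.lookup w i *\<^sub>R Poly_Mapping.single i 1) k"
    by (simp add: lookup_sum lookup_scaleR_poly lookup_single when_def if_distrib sum.delta cong: if_cong)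
qed

lemma diff_in_rspace: "u \<in> rspace d \<Longrightarrow> w \<in> rspace d \<Longrightarrow> u - w \<in> rspace d"
  using keys_diff[of u w] by (auto simp: rspace_def)

lemma dot_adj:
  assumes "linear L" "w \<in> rspace d"
  shows "dot (adj d L m) w = dot (L w) m"
proof -
  have "dot (L w) m = dot (L (\<Sum>i<d. Poly_Mapping.lookup w i *\<^sub>R Poly_Mapping.single i 1)) m"
    using rspace_expansion[OF assms(2)] by simp
  also have "\<dots> = (\<Sum>i<d. Poly_Mapping.lookup w i * dot (L (Poly_Mapping.single i 1)) m)"
    by (simp add: linear_sum[OF assms(1)] linear_scale[OF assms(1)] dot_sum_left dot_scaleR_left)
  finally show ?thesis
    by (simp add: adj_def dot_sum_left dot_single mult.commute)
qed

section \<open>Cuts and the lower approximations\<close>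

text \<open>The Lagrangian at a point \<open>z\<close> depends on the right-hand side through an affine function
  with slope \<open>cut_slope\<close>, whatever \<open>z\<close> is. At \<open>w\<close> its penalty is nonpositive for every
  \<open>z\<close> feasible there, and at \<open>u\<close> its infimum is the optimal value, as there is no duality
  gap.\<close>

lemma cut_below_optimal_value:
  assumes prob: "convex_problem P" and t: "t \<in> {2..stages P}"
    and mult: "optimal_multiplier P t u g y"
    and u: "u \<in> rspace (dimx P (t - 1))" and w: "w \<in> rspace (dimx P (t - 1))"
  shows "(INF z\<in>feas P t u. g z) + ereal (dot (cut_slope P t y) (w - u))
           \<le> (INF z\<in>feas P t w. g z)"
proof (rule INF_greatest)
  fix z assume z: "z \<in> feas P t w"
  let ?B = "opB P t" and ?Q = "opQ P t" and ?\<mu> = "fst y" and ?\<nu> = "snd y" and ?I = "{..<dimi P t}"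
  have lin: "linear ?B" "linear ?Q" and Qsp: "?Q ` rspace (dimx P (t - 1)) \<subseteq> rspace (dimi P t)"
    using prob t by (auto simp: convex_problem_def linear_between_def)
  have zX: "z \<in> Xbar P t" and eq: "opA P t z = ?B w + rhs P t"
    and ineq: "\<And>i. i < dimi P t \<Longrightarrow> phi P t i z \<le> Poly_Mapping.lookup (?Q w) i"
    using z t by (auto simp: feas_def)
  have nonneg: "\<And>i. 0 \<le> Poly_Mapping.lookup ?\<nu> i"
    and gap: "dual_fun P t u g y = (INF z\<in>feas P t u. g z)"
    using mult by (auto simp: optimal_multiplier_def dual_feasible_def)
  \<comment> \<open>The penalty term of the Lagrangian at \<open>z\<close>, as a function of the right-hand side.\<close>
  define l where "l = (\<lambda>v. dot (?B v + rhs P t - opA P t z) ?\<mu> +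
      (\<Sum>i\<in>?I. Poly_Mapping.lookup ?\<nu> i * (phi P t i z - Poly_Mapping.lookup (?Q v) i)))"
  have wu: "w - u \<in> rspace (dimx P (t - 1))"
    using u w by (rule diff_in_rspace[rotated])
  have "Poly_Mapping.keys (?Q (w - u)) \<subseteq> ?I"
    using Qsp wu by (auto simp: rspace_def)
  then have "dot (?Q (w - u)) ?\<nu>
      = (\<Sum>i\<in>?I. Poly_Mapping.lookup (?Q (w - u)) i * Poly_Mapping.lookup ?\<nu> i)"
    by (intro dot_eq_sum) auto
  then have "dot (cut_slope P t y) (w - u) = dot (?B w - ?B u) ?\<mu>
      - (\<Sum>i\<in>?I. (Poly_Mapping.lookup (?Q w) i - Poly_Mapping.lookup (?Q u) i) * Poly_Mapping.lookup ?\<nu> i)"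
    by (simp add: cut_slope_def dot_diff_left dot_adj[OF lin(1) wu] dot_adj[OF lin(2) wu]
        linear_diff[OF lin(1)] linear_diff[OF lin(2)] lookup_minus del: One_nat_def)
  then have shift: "l u + dot (cut_slope P t y) (w - u) = l w"
    by (simp add: l_def dot_diff_left dot_add_left algebra_simps sum.distrib sum_subtractf)
  have "(\<Sum>i\<in>?I. Poly_Mapping.lookup ?\<nu> i * (phi P t i z - Poly_Mapping.lookup (?Q w) i)) \<le> 0"
    using nonneg ineq by (intro sum_nonpos mult_nonneg_nonpos) auto
  then have neg: "l w \<le> 0"
    using eq by (simp add: l_def dot_def)
  have "(INF z\<in>feas P t u. g z) \<le> g z + ereal (l u)"
    unfolding gap[symmetric] dual_fun_def l_def using zX by (intro INF_lower)
  then have "(INF z\<in>feas P t u. g z) + ereal (dot (cut_slope P t y) (w - u))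
      \<le> g z + ereal (l u) + ereal (dot (cut_slope P t y) (w - u))"
    by (rule add_right_mono)
  also have "\<dots> = g z + ereal (l w)"
    using shift by (simp add: add.assoc)
  also have "\<dots> \<le> g z + 0"
    using neg by (intro add_left_mono) simp
  finally show "(INF z\<in>feas P t u. g z) + ereal (dot (cut_slope P t y) (w - u)) \<le> g z"
    by simp
qed

lemma feas_subset_rspace:
  assumes "convex_problem P" "t \<in> {1..stages P}"
  shows "feas P t u \<subseteq> rspace (dimx P t)"
  using assms by (auto simp: convex_problem_def feas_def)

lemma disc_scale_mono:
  assumes "convex_problem P" "a \<le> b"
  shows "ereal (disc P) * a \<le> ereal (disc P) * b"
  using assms by (intro ereal_mult_left_mono) (auto simp: convex_problem_def)

lemma vfun_eq: "t \<le> stages P \<Longrightarrow> vfun P t u = (INF z\<in>feas P t u. ffun P t z)"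
  by (subst vfun.simps) (simp add: ffun_def)

lemma lowv_Suc:
  assumes "t \<le> stages P"
  shows "lowv P x y (Suc k) t u = max (lowv P x y k t u)
      ((INF z\<in>feas P t (x (Suc k) (t - 1)). lowf P x y (Suc k) t z)
        + ereal (dot (cut_slope P t (y (Suc k) t)) (u - x (Suc k) (t - 1))))"
  using assms by (subst lowv.simps) (simp add: lowf_def)

lemma lowv_beyond: "stages P < t \<Longrightarrow> lowv P x y k t u = 0"
  by (subst lowv.simps) simp

lemma vfun_beyond: "stages P < t \<Longrightarrow> vfun P t u = 0"
  by (subst vfun.simps) simp

lemma lowv_mono:
  assumes "j \<le> k"
  shows "lowv P x y j t u \<le> lowv P x y k t u"
  using assms
proof (induction rule: dec_induct)
  case (step n)
  have "lowv P x y n t u \<le> lowv P x y (Suc n) t u"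
    by (cases "stages P < t") (auto simp: lowv_beyond lowv_Suc)
  with step show ?case by simp
qed simp

lemma lowf_mono:
  assumes "convex_problem P" "j \<le> k"
  shows "lowf P x y j t u \<le> lowf P x y k t u"
  unfolding lowf_def using assms by (intro add_left_mono disc_scale_mono lowv_mono)

lemma search_point_feasible:
  assumes "ddp_run P x y" "1 \<le> k" "t \<in> {1..stages P}"
  shows "x k t \<in> feas P t (x k (t - 1))"
  using assms by (auto simp: ddp_run_def is_arg_min_def)

lemma search_point_minimal:
  assumes "ddp_run P x y" "1 \<le> k" "t \<in> {1..stages P}"
  shows "(INF z\<in>feas P t (x k (t - 1)). lowf P x y (k - 1) t z) = lowf P x y (k - 1) t (x k t)"
proof -
  have "is_arg_min (lowf P x y (k - 1) t) (\<lambda>z. z \<in> feas P t (x k (t - 1))) (x k t)"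
    using assms by (auto simp: ddp_run_def)
  then show ?thesis
    by (intro antisym INF_lower INF_greatest) (auto simp: is_arg_min_linorder)
qed

lemma search_point_in_region:
  assumes "ddp_run P x y" "1 \<le> k" "t \<in> {1..stages P}"
  shows "x k t \<in> region P t"
proof -
  have "t \<ge> 1 \<Longrightarrow> t \<le> stages P \<Longrightarrow> x k t \<in> region P t"
  proof (induction t rule: dec_induct)
    case base
    then show ?case
      using search_point_feasible[OF assms(1,2), of 1] by (auto simp: feas_def)
  next
    case (step n)
    then show ?case
      using search_point_feasible[OF assms(1,2), of "Suc n"] by auto
  qed
  with assms(3) show ?thesis by auto
qed

lemma search_point_in_rspace:
  assumes "convex_problem P" "ddp_run P x y" "1 \<le> k" "t \<in> {1..stages P}"
  shows "x k t \<in> rspace (dimx P t)"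
  using search_point_feasible[OF assms(2-4)] feas_subset_rspace[OF assms(1,4)] by auto

text \<open>The cut of stage \<open>t\<close> built in an iteration uses the approximation of stage \<open>t + 1\<close> of
  the same iteration, so the induction on the iteration number contains one that runs backwards
  through the stages.\<close>

lemma lowv_le_vfun:
  assumes prob: "convex_problem P" and run: "ddp_run P x y"
  shows "2 \<le> t \<Longrightarrow> w \<in> rspace (dimx P (t - 1)) \<Longrightarrow> lowv P x y k t w \<le> vfun P t w"
proof (induction k arbitrary: t w)
  case 0
  then show ?case
    by (subst lowv.simps) (auto simp: vfun_beyond)
next
  case (Suc k)
  note outer = Suc.IH
  show ?case
    using Suc.prems
  proof (induction "Suc (stages P) - t" arbitrary: t w rule: less_induct)
    case less
    show ?case
    proof (cases "stages P < t")
      case True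
      then show ?thesis by (simp add: lowv_beyond vfun_beyond)
    next
      case False
      let ?u = "x (Suc k) (t - 1)" and ?f = "lowf P x y (Suc k) t"
      have t: "t \<in> {2..stages P}" "t - 1 \<in> {1..stages P}"
        using False less.prems by auto
      have "(INF z\<in>feas P t ?u. ?f z) + ereal (dot (cut_slope P t (y (Suc k) t)) (w - ?u))
          \<le> (INF z\<in>feas P t w. ?f z)"
        using run t(1) search_point_in_rspace[OF prob run _ t(2), of "Suc k"] less.prems
        by (intro cut_below_optimal_value[OF prob t(1)]) (auto simp: ddp_run_def)
      also have "\<dots> \<le> vfun P t w"
        unfolding vfun_eq[OF leI[OF False]]
      proof (rule INF_superset_mono[OF order_refl])
        fix z assume z: "z \<in> feas P t w"
        then have "z \<in> rspace (dimx P (Suc t - 1))"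
          using feas_subset_rspace[OF prob, of t w] t by auto
        then have "lowv P x y (Suc k) (Suc t) z \<le> vfun P (Suc t) z"
          using less.prems t by (intro less.hyps) auto
        then show "?f z \<le> ffun P t z"
          unfolding lowf_def ffun_def by (intro add_left_mono disc_scale_mono prob)
      qed
      finally show ?thesis
        using False outer[OF less.prems] by (simp add: lowv_Suc)
    qed
  qed
qed

lemma lowf_le_ffun:
  assumes "convex_problem P" "ddp_run P x y" "t \<in> {1..stages P}" "z \<in> rspace (dimx P t)"
  shows "lowf P x y k t z \<le> ffun P t z"
  unfolding lowf_def ffun_def using assms
  by (intro add_left_mono disc_scale_mono lowv_le_vfun) auto

text \<open>The affine term of the newest cut vanishes at the point where the cut is built.\<close>

lemma lowv_at_search_point:
  assumes "1 \<le> k" "1 \<le> t" "t < stages P"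
  shows "(INF z\<in>feas P (Suc t) (x k t). lowf P x y k (Suc t) z) \<le> lowv P x y k (Suc t) (x k t)"
proof -
  obtain j where "k = Suc j" using assms by (cases k) auto
  moreover have "\<And>a. dot a 0 = 0" by (simp add: dot_def)
  ultimately show ?thesis
    using assms by (simp add: lowv_Suc)
qed

section \<open>Saturation\<close>

text \<open>In the extended reals \<open>\<infinity> - \<infinity> = \<infinity>\<close>, so a Lipschitz bound, applied to
  a point and itself, excludes infinite values. This is what allows the estimates below to be
  carried out with real numbers.\<close>

lemma finite_if_Lipschitz:
  fixes F :: "'a::minus \<Rightarrow> ereal"
  assumes "\<forall>z\<in>R. \<forall>z'\<in>R. \<bar>F z - F z'\<bar> \<le> ereal (C * N (z - z'))" and "z \<in> R"
  shows "\<bar>F z\<bar> \<noteq> \<infinity>"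
proof -
  have "\<bar>F z - F z\<bar> \<le> ereal (C * N (z - z))"
    using assms by blast
  then show ?thesis
    by (cases "F z") auto
qed

lemma finite_continuation:
  assumes "\<bar>b + ereal c * a\<bar> \<noteq> \<infinity>" "0 < c"
  shows "\<bar>b\<bar> \<noteq> \<infinity> \<and> \<bar>a\<bar> \<noteq> \<infinity>"
  using assms by (cases a; cases b; auto)

text \<open>At the last stage the true and the approximate objective agree, so the cut is exact.\<close>

lemma saturated_last:
  assumes "1 \<le> k" "2 \<le> stages P"
  shows "vfun P (stages P) (x k (stages P - 1)) \<le> lowv P x y k (stages P) (x k (stages P - 1))"
proof -
  have "ffun P (stages P) = lowf P x y k (stages P)"
    by (auto simp: ffun_def lowf_def lowv_beyond vfun_beyond)
  then show ?thesis
    using lowv_at_search_point[of k "stages P - 1" P x y] assms by (simp add: vfun_eq)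
qed

text \<open>The search point of stage \<open>t + 1\<close> attains the minimum of the old approximate objective.
  That minimum is at most the new one, which is the height of the newest cut at the
  preceding search point; so the gap between true and old approximate objective passes to the
  preceding stage.\<close>

lemma saturated_previous:
  assumes prob: "convex_problem P" and run: "ddp_run P x y" and k: "1 \<le> k"
    and t: "1 \<le> t" "t < stages P"
    and gap: "ffun P (Suc t) (x k (Suc t)) \<le> lowf P x y (k - 1) (Suc t) (x k (Suc t)) + ereal e"
  shows "vfun P (Suc t) (x k t) \<le> lowv P x y k (Suc t) (x k t) + ereal e"
proof -
  have St: "Suc t \<in> {1..stages P}" using t by auto
  have "vfun P (Suc t) (x k t) \<le> ffun P (Suc t) (x k (Suc t))"
    using search_point_feasible[OF run k St] t by (auto simp: vfun_eq intro!: INF_lower)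
  also have "\<dots> \<le> (INF z\<in>feas P (Suc t) (x k t). lowf P x y (k - 1) (Suc t) z) + ereal e"
    using gap search_point_minimal[OF run k St] by simp
  also have "\<dots> \<le> (INF z\<in>feas P (Suc t) (x k t). lowf P x y k (Suc t) z) + ereal e"
    by (intro add_right_mono INF_superset_mono lowf_mono[OF prob]) auto
  also have "\<dots> \<le> lowv P x y k (Suc t) (x k t) + ereal e"
    by (intro add_right_mono lowv_at_search_point k t)
  finally show ?thesis .
qed

text \<open>Only finitely many search points precede iteration \<open>k\<close>, so the infimum of the distances
  is attained unless there are none, in which case it is \<open>\<infinity>\<close>.\<close>

lemma indistinguishable_near_saturated:
  assumes "\<not> distinguishable P x y e d k t" "t < stages P"
  obtains j where "1 \<le> j" "j < k" "saturated P x y e j t" "nrm P t (x j t - x k t) \<le> d"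
proof -
  let ?S = "sat_points P x y e k t" and ?n = "\<lambda>s. ereal (nrm P t (s - x k t))"
  have fin: "finite ?S"
    by (rule finite_subset[of _ "(\<lambda>j. x j t) ` {..<k}"]) (auto simp: sat_points_def)
  have le: "(INF s\<in>?S. ?n s) \<le> ereal d"
    using assms by (simp add: distinguishable_def not_less)
  then have ne: "?S \<noteq> {}"
    by (auto simp: top_ereal_def)
  have "(INF s\<in>?S. ?n s) = Min (?n ` ?S)"
    using fin ne by (simp add: Min_Inf)
  moreover have "Min (?n ` ?S) \<in> ?n ` ?S"
    using fin ne by (intro Min_in) auto
  ultimately obtain s where "s \<in> ?S" "?n s \<le> ereal d"
    using le by auto
  with that show ?thesis
    by (auto simp: sat_points_def)
qed

text \<open>The gap between the two objectives at the nearby older point is at most the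
  discounted saturation error, which cannot have increased since that point was generated. The Lipschitz
  bounds transfer it to the current point. The existence of an older point also shows that the
  current iteration is not the first, so the approximate objective of the previous iteration is
  covered by the second Lipschitz bound.\<close>

lemma gap_at_indistinguishable_point:
  fixes M LM d e :: real
  assumes prob: "convex_problem P" and run: "ddp_run P x y"
    and t: "1 \<le> t" "t < stages P"
    and M: "0 \<le> M" "\<forall>z\<in>region P t. \<forall>z'\<in>region P t.
         \<bar>ffun P t z - ffun P t z'\<bar> \<le> ereal (M * nrm P t (z - z'))"
    and LM: "0 \<le> LM" "\<forall>j\<ge>1. \<forall>z\<in>region P t. \<forall>z'\<in>region P t.
         \<bar>lowf P x y j t z - lowf P x y j t z'\<bar> \<le> ereal (LM * nrm P t (z - z'))"
    and k: "1 \<le> k" and indist: "\<not> distinguishable P x y e d k t"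
  shows "2 \<le> k"
    and "ffun P t (x k t) \<le> lowf P x y (k - 1) t (x k t) + ereal ((M + LM) * d + disc P * e)"
proof -
  obtain j where j: "1 \<le> j" "j < k" "saturated P x y e j t"
    and near: "nrm P t (x j t - x k t) \<le> d"
    using indistinguishable_near_saturated[OF indist t(2)] .
  show k2: "2 \<le> k" using j by auto
  have l: "0 < disc P" using prob by (simp add: convex_problem_def)
  let ?s = "x j t" and ?x = "x k t" and ?f = "ffun P t" and ?g = "lowf P x y (k - 1) t"
  have reg: "?s \<in> region P t" "?x \<in> region P t"
    using search_point_in_region[OF run] j k t by auto
  have dF: "\<bar>?f ?s - ?f ?x\<bar> \<le> ereal (M * nrm P t (?s - ?x))"
    and dG: "\<bar>?g ?s - ?g ?x\<bar> \<le> ereal (LM * nrm P t (?s - ?x))"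
    using M(2) LM(2) reg k2 by auto
  have fin: "\<bar>?f z\<bar> \<noteq> \<infinity>" "\<bar>?g z\<bar> \<noteq> \<infinity>" "\<bar>lowf P x y j t z\<bar> \<noteq> \<infinity>" if "z \<in> region P t" for z
    using finite_if_Lipschitz[OF M(2) that] k2 j(1)
      finite_if_Lipschitz[OF LM(2)[THEN spec, THEN mp] that] by auto
  have "\<bar>hobj P t ?s\<bar> \<noteq> \<infinity>" "\<bar>vfun P (Suc t) ?s\<bar> \<noteq> \<infinity>"
    "\<bar>lowv P x y (k - 1) (Suc t) ?s\<bar> \<noteq> \<infinity>" "\<bar>lowv P x y j (Suc t) ?s\<bar> \<noteq> \<infinity>"
    using fin[OF reg(1), unfolded ffun_def lowf_def, THEN finite_continuation[OF _ l]] by simp_all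
  then obtain h v a b where r: "hobj P t ?s = ereal h" "vfun P (Suc t) ?s = ereal v"
      "lowv P x y (k - 1) (Suc t) ?s = ereal a" "lowv P x y j (Suc t) ?s = ereal b"
    by fastforce
  obtain fx gx where x: "?f ?x = ereal fx" "?g ?x = ereal gx"
    using fin(1,2)[OF reg(2)] by fastforce
  have s: "?f ?s = ereal (h + disc P * v)" "?g ?s = ereal (h + disc P * a)"
    by (simp_all add: ffun_def lowf_def r del: One_nat_def)
  have "b \<le> a"
    using lowv_mono[of j "k - 1" P x y "Suc t" ?s] j by (simp add: r del: One_nat_def)
  moreover have "v - b \<le> e"
    using j(3) by (simp add: saturated_def r)
  ultimately have "disc P * (v - a) \<le> disc P * e"
    using l by (intro mult_left_mono) auto
  moreover have "\<bar>h + disc P * v - fx\<bar> \<le> M * nrm P t (?s - ?x)"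
    "\<bar>h + disc P * a - gx\<bar> \<le> LM * nrm P t (?s - ?x)"
    using dF dG by (simp_all add: s x del: One_nat_def)
  moreover have "M * nrm P t (?s - ?x) \<le> M * d" "LM * nrm P t (?s - ?x) \<le> LM * d"
    using near M(1) LM(1) by (auto intro: mult_left_mono)
  ultimately have "fx \<le> gx + ((M + LM) * d + disc P * e)"
    by (simp add: algebra_simps abs_le_iff)
  then show "?f ?x \<le> ?g ?x + ereal ((M + LM) * d + disc P * e)"
    by (simp add: x del: One_nat_def)
qed

lemma eps_recursion:
  assumes "Suc t < stages P"
  shows "eps P M LM \<delta> t
    = (M (Suc t) + LM (Suc t)) * \<delta> (Suc t) + disc P * eps P M LM \<delta> (Suc t)"
proof (cases "Suc t = stages P - 1")
  case True
  then have "stages P - 2 = t" by simp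
  with True show ?thesis by (simp add: eps_def)
next
  case False
  let ?c = "\<lambda>\<tau>. (M (\<tau> + 1) + LM (\<tau> + 1)) * \<delta> (\<tau> + 1)"
  have "eps P M LM \<delta> t = (\<Sum>\<tau>=t..stages P - 2. ?c \<tau> * disc P ^ (\<tau> - t))"
    using assms by (simp add: eps_def)
  also have "\<dots> = ?c t + (\<Sum>\<tau>=Suc t..stages P - 2. ?c \<tau> * disc P ^ (\<tau> - t))"
    using assms False by (subst sum.atLeast_Suc_atMost) auto
  also have "(\<Sum>\<tau>=Suc t..stages P - 2. ?c \<tau> * disc P ^ (\<tau> - t))
      = disc P * (\<Sum>\<tau>=Suc t..stages P - 2. ?c \<tau> * disc P ^ (\<tau> - Suc t))"
    unfolding sum_distrib_left
  proof (rule sum.cong)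
    fix \<tau> assume "\<tau> \<in> {Suc t..stages P - 2}"
    then have "\<tau> - t = Suc (\<tau> - Suc t)" by auto
    then show "?c \<tau> * disc P ^ (\<tau> - t) = disc P * (?c \<tau> * disc P ^ (\<tau> - Suc t))"
      by simp
  qed simp
  finally show ?thesis
    using False by (simp add: eps_def)
qed

section \<open>The policy bound\<close>

text \<open>Intended reading along the policy: \<open>h\<close> is the stage cost, \<open>g\<close> the approximate objective,
  \<open>w\<close> the approximate cost-to-go and \<open>e\<close> the gap. The inductive bound on the first \<open>n\<close>
  summands carries \<open>- l ^ n * w n\<close>, which cancels against the next use of the second
  inequality and vanishes at the last stage.\<close>

lemma discounted_telescope:
  fixes h g w e :: "nat \<Rightarrow> real"
  assumes "0 \<le> l" "1 \<le> T"
    and "\<And>t. 1 \<le> t \<Longrightarrow> t \<le> T \<Longrightarrow> h t = g t - l * w t"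
    and "\<And>t. 1 \<le> t \<Longrightarrow> t < T \<Longrightarrow> l * g (Suc t) \<le> l * w t + e t"
    and "w T = 0" "e T = 0"
  shows "(\<Sum>t=1..T. l ^ (t - 1) * h t) \<le> g 1 + (\<Sum>t=1..T. l ^ (t - 1) * e t)"
proof -
  have "(\<Sum>t=1..n. l ^ (t - 1) * h t) \<le> g 1 - l ^ n * w n + (\<Sum>t=1..<n. l ^ (t - 1) * e t)"
    if "1 \<le> n" "n \<le> T" for n
    using that
  proof (induction rule: dec_induct)
    case base
    then show ?case using assms(2,3) by simp
  next
    case (step n)
    have ln: "l ^ n = l ^ (n - 1) * l"
      using step by (cases n) auto
    have "l ^ (n - 1) * (l * g (Suc n)) \<le> l ^ (n - 1) * (l * w n + e n)"
      using step assms(1) by (intro mult_left_mono assms(4)) auto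
    then have "l ^ n * g (Suc n) \<le> l ^ n * w n + l ^ (n - 1) * e n"
      by (simp add: ln algebra_simps)
    moreover have "l ^ n * h (Suc n) = l ^ n * g (Suc n) - l ^ Suc n * w (Suc n)"
      using assms(3)[of "Suc n"] step.prems by (simp add: right_diff_distrib)
    moreover have "(\<Sum>t=1..Suc n. l ^ (t - 1) * h t) = (\<Sum>t=1..n. l ^ (t - 1) * h t) + l ^ n * h (Suc n)"
      by simp
    moreover have "(\<Sum>t=1..<Suc n. l ^ (t - 1) * e t) = (\<Sum>t=1..<n. l ^ (t - 1) * e t) + l ^ (n - 1) * e n"
      using step by simp
    ultimately show ?case
      using step.IH step.prems by linarith
  qed
  from this[of T] assms(2,5) have
    "(\<Sum>t=1..T. l ^ (t - 1) * h t) \<le> g 1 + (\<Sum>t=1..<T. l ^ (t - 1) * e t)"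
    by simp
  also have "{1..T} = insert T {1..<T}"
    using assms(2) by auto
  then have "(\<Sum>t=1..<T. l ^ (t - 1) * e t) = (\<Sum>t=1..T. l ^ (t - 1) * e t)"
    using assms(6) by simp
  finally show ?thesis .
qed

theorem proposition3:
  fixes P :: problem
    and x :: "nat \<Rightarrow> nat \<Rightarrow> rvec"
    and y :: "nat \<Rightarrow> nat \<Rightarrow> rvec \<times> rvec"
    and D M LM \<delta> :: "nat \<Rightarrow> real"
    and k :: nat
  assumes problem: "convex_problem P"
    and bounded: "\<forall>t\<in>{1..stages P}. 0 \<le> D t \<and>
      (\<forall>z\<in>region P t. \<forall>z'\<in>region P t. nrm P t (z - z') \<le> D t)"
    and regular: "\<forall>t\<in>{1..stages P}. \<exists>e>0. \<forall>z\<in>enlarged_region P t e.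
      hobj P t z < \<infinity> \<and> (t \<le> stages P - 1 \<longrightarrow> rel_interior (feas P (t + 1) z) \<noteq> {})"
    and lipschitz: "\<forall>t\<in>{1..stages P}. 0 \<le> M t \<and>
      (\<forall>z\<in>region P t. \<forall>z'\<in>region P t.
         \<bar>ffun P t z - ffun P t z'\<bar> \<le> ereal (M t * nrm P t (z - z')))"
    and run: "ddp_run P x y"
    and lipschitz_low: "\<forall>t\<in>{1..stages P}. 0 \<le> LM t \<and>
      (\<forall>j\<ge>1. \<forall>z\<in>region P t. \<forall>z'\<in>region P t.
         \<bar>lowf P x y j t z - lowf P x y j t z'\<bar> \<le> ereal (LM t * nrm P t (z - z')))"
    and delta: "\<forall>t\<in>{1..stages P}. 0 \<le> \<delta> t"
    and iter: "1 \<le> k"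
  shows "(\<exists>t\<in>{1..stages P - 1}.
            distinguishable P x y (eps P M LM \<delta> t) (\<delta> t) k t \<and>
            saturated P x y (eps P M LM \<delta> t) k t) \<or>
         (feasible_policy P (x k) \<and>
          ffun P 1 (x k 1) - fstar P \<le> ereal (eps P M LM \<delta> 0) \<and>
          (\<Sum>t=1..stages P. ereal (disc P ^ (t - 1)) * hobj P t (x k t)) -
            lowf P x y (k - 1) 1 (x k 1)
          \<le> ereal (\<Sum>t=1..stages P. disc P ^ (t - 1) * eps P M LM \<delta> (t - 1)))"
proof (rule disj_imp[THEN iffD2, OF impI])
  assume none: "\<not> (\<exists>t\<in>{1..stages P - 1}.
            distinguishable P x y (eps P M LM \<delta> t) (\<delta> t) k t \<and>
            saturated P x y (eps P M LM \<delta> t) k t)"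
  let ?T = "stages P" and ?l = "disc P" and ?e = "eps P M LM \<delta>"
  let ?g = "\<lambda>t. lowf P x y (k - 1) t (x k t)" and ?f = "\<lambda>t. ffun P t (x k t)"
  have T: "2 \<le> ?T" and l: "0 < ?l"
    using problem by (auto simp: convex_problem_def)
  have reg: "x k t \<in> region P t" if "t \<in> {1..?T}" for t
    using search_point_in_region[OF run iter that] .
  have finF: "\<bar>?f t\<bar> \<noteq> \<infinity>" and finL: "1 \<le> j \<Longrightarrow> \<bar>lowf P x y j t (x k t)\<bar> \<noteq> \<infinity>"
    if "t \<in> {1..?T}" for t j
    using finite_if_Lipschitz[OF lipschitz[THEN bspec, OF that, THEN conjunct2] reg[OF that]]
      finite_if_Lipschitz[OF lipschitz_low[THEN bspec, OF that, THEN conjunct2, THEN spec, THEN mp]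
        reg[OF that]] by auto
  have saturatedI: "saturated P x y e k t"
    if "1 \<le> t" "t < ?T" "vfun P (Suc t) (x k t) \<le> lowv P x y k (Suc t) (x k t) + ereal e" for t e
  proof -
    have "\<bar>lowv P x y k (Suc t) (x k t)\<bar> \<noteq> \<infinity>"
      using finL[of t k, unfolded lowf_def, THEN finite_continuation[OF _ l]] iter that by auto
    with that(3) show ?thesis
      by (auto simp: saturated_def ereal_minus_le_iff add.commute)
  qed
  have gap_step: "2 \<le> k \<and> ?f t \<le> ?g t + ereal (?e (t - 1))"
    if t: "1 \<le> t" "t < ?T" and sat: "saturated P x y (?e t) k t" for t
  proof -
    have "\<not> distinguishable P x y (?e t) (\<delta> t) k t"
      using none t sat by auto
    with gap_at_indistinguishable_point[OF problem run t, of "M t" "LM t" k "?e t" "\<delta> t"]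
    have "2 \<le> k" "?f t \<le> ?g t + ereal ((M t + LM t) * \<delta> t + ?l * ?e t)"
      using lipschitz lipschitz_low iter t by auto
    then show ?thesis
      using eps_recursion[of "t - 1" P M LM \<delta>] t by simp
  qed
  have sat: "saturated P x y (?e t) k t" if "1 \<le> t" "t \<le> ?T - 1" for t
    using that(2,1)
  proof (induction rule: inc_induct)
    case base
    have "?e (?T - 1) = 0" by (simp add: eps_def)
    then show ?case
      using T saturated_last[OF iter T, of x y] by (intro saturatedI) auto
  next
    case (step t)
    then have "?f (Suc t) \<le> ?g (Suc t) + ereal (?e t)"
      using gap_step[of "Suc t"] by auto
    then show ?case
      using step by (intro saturatedI saturated_previous[OF problem run iter]) auto
  qed
  \<comment> \<open>In the first iteration there are no older points, so the saturated point of stage \<open>1\<close>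
      would be distinguishable, contradicting \<open>none\<close>. Hence the approximate objectives of iteration \<open>k - 1\<close> are finite from here on.\<close>
  have k: "2 \<le> k"
    using gap_step[of 1] sat[of 1] T by auto
  have gap: "?f t \<le> ?g t + ereal (?e (t - 1))" if "1 \<le> t" "t < ?T" for t
    using gap_step[OF that] sat[of t] that by auto
  have finG: "\<bar>?g t\<bar> \<noteq> \<infinity>" if "t \<in> {1..?T}" for t
    using finL[OF that, of "k - 1"] k by simp

  have feasible: "feasible_policy P (x k)"
    using search_point_feasible[OF run iter] by (simp add: feasible_policy_def)

  have feas1: "feas P 1 u = feas P 1 0" for u
    by (simp add: feas_def)
  have "?g 1 = (INF z\<in>feas P 1 0. lowf P x y (k - 1) 1 z)"
    using search_point_minimal[OF run iter, of 1] T by (simp add: feas1[of "x k 0", simplified])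
  also have "\<dots> \<le> fstar P"
    unfolding fstar_def
  proof (rule INF_superset_mono[OF order_refl])
    fix z assume z: "z \<in> feas P 1 0"
    then have "z \<in> rspace (dimx P 1)"
      using feas_subset_rspace[OF problem, of 1 0] T by auto
    then show "lowf P x y (k - 1) 1 z \<le> ffun P 1 z"
      using T by (intro lowf_le_ffun problem run) auto
  qed
  finally have lower: "?g 1 \<le> fstar P" .
  have upper: "?f 1 \<le> ?g 1 + ereal (?e 0)"
    using gap[of 1] T by simp
  have optimality: "ffun P 1 (x k 1) - fstar P \<le> ereal (?e 0)"
  proof -
    have "?f 1 - fstar P \<le> ?f 1 - ?g 1"
      using lower by (intro ereal_minus_mono) auto
    also have "\<dots> \<le> ereal (?e 0)"
      using upper finG[of 1] T by (auto simp: ereal_minus_le_iff add.commute)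
    finally show ?thesis .
  qed

  define h where "h t = real_of_ereal (hobj P t (x k t))" for t
  define g where "g t = real_of_ereal (?g t)" for t
  define w where "w t = real_of_ereal (lowv P x y (k - 1) (Suc t) (x k t))" for t
  define v where "v t = real_of_ereal (vfun P (Suc t) (x k t))" for t
  have real: "hobj P t (x k t) = ereal (h t)" "?g t = ereal (g t)"
    "lowv P x y (k - 1) (Suc t) (x k t) = ereal (w t)" "vfun P (Suc t) (x k t) = ereal (v t)"
    if "t \<in> {1..?T}" for t
    using finG[OF that] finG[OF that, unfolded lowf_def, THEN finite_continuation[OF _ l]]
      finF[OF that, unfolded ffun_def, THEN finite_continuation[OF _ l]]
    unfolding h_def g_def w_def v_def by (simp_all add: ereal_real)
  have "(\<Sum>t=1..?T. ?l ^ (t - 1) * h t) \<le> g 1 + (\<Sum>t=1..?T. ?l ^ (t - 1) * ?e (t - 1))"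
  proof (rule discounted_telescope[where w = w])
    show "h t = g t - ?l * w t" if "1 \<le> t" "t \<le> ?T" for t
    proof -
      have "?g t = hobj P t (x k t) + ereal ?l * lowv P x y (k - 1) (Suc t) (x k t)"
        by (simp add: lowf_def)
      then show ?thesis
        using real[of t] that by simp
    qed
  next
    fix t assume t: "1 \<le> t" "t < ?T"
    have "?g (Suc t) = (INF z\<in>feas P (Suc t) (x k t). lowf P x y (k - 1) (Suc t) z)"
      using search_point_minimal[OF run iter, of "Suc t"] t by simp
    also have "\<dots> \<le> vfun P (Suc t) (x k t)"
      using t feas_subset_rspace[OF problem, of "Suc t" "x k t"]
        lowf_le_ffun[OF problem run, of "Suc t"]
      by (subst vfun_eq) (auto intro!: INF_superset_mono)
    finally have "g (Suc t) \<le> v t"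
      using real[of "Suc t"] real[of t] t by simp
    then have "?l * g (Suc t) \<le> ?l * v t"
      using l by simp
    moreover have "h t + ?l * v t \<le> h t + ?l * w t + ?e (t - 1)"
      using gap[OF t] real[of t] t by (simp add: lowf_def ffun_def)
    ultimately show "?l * g (Suc t) \<le> ?l * w t + ?e (t - 1)"
      by simp
  next
    show "w ?T = 0" by (simp add: w_def lowv_beyond)
    show "?e (?T - 1) = 0" by (simp add: eps_def)
  qed (use T l in auto)
  moreover have "(\<Sum>t=1..?T. ereal (?l ^ (t - 1)) * hobj P t (x k t))
      = ereal (\<Sum>t=1..?T. ?l ^ (t - 1) * h t)"
    unfolding sum_ereal[symmetric] by (intro sum.cong) (simp_all add: real)
  ultimately have policy: "(\<Sum>t=1..?T. ereal (?l ^ (t - 1)) * hobj P t (x k t)) - ?g 1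
      \<le> ereal (\<Sum>t=1..?T. ?l ^ (t - 1) * ?e (t - 1))"
    using real(2)[of 1] T by simp
  show "feasible_policy P (x k) \<and> ffun P 1 (x k 1) - fstar P \<le> ereal (?e 0) \<and>
      (\<Sum>t=1..?T. ereal (?l ^ (t - 1)) * hobj P t (x k t)) - ?g 1
      \<le> ereal (\<Sum>t=1..?T. ?l ^ (t - 1) * ?e (t - 1))"
    using feasible optimality policy by blast
qed

end
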